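(* For all integers $n,m\ge 2$, $$1\le b(P_n\boxtimes P_m)\le 5.$$
   Context: All graphs are finite, simple and undirected. $P_k$ denotes the path with $k$ vertices. The strong product $G\boxtimes H$ of graphs $G$ and $H$ has vertex set $V(G)\times V(H)$, and two vertices $(v,u)$ and $(v',u')$ are adjacent if and only if ($v=v'$ and $u\sim u'$), or ($v\sim v'$ and $u=u'$), or ($v\sim v'$ and $u\sim u'$), where $\sim$ denotes adjacency. A set $D$ of vertices of $G$ is dominating if every vertex of $G$ is in $D$ or adjacent to a vertex of $D$; the domination number $\gamma(G)$ is the minimum cardinality of a dominating set. For a graph $G$ with nonempty edge set $E$, the bondage number $b(G)$ is the minimum cardinality of a set $E'\subseteq E$ such that $\gamma(G-E')>\gamma(G)$, where $G-E'$ is obtained from $G$ by deleting the edges of $E'$ and keeping all vertices. *)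

theory Defs
  imports Complex_Main
begin

record 'a ugraph =
  verts :: "'a set"
  edges :: "'a set set"

definition finite_simple_graph :: "'a ugraph \<Rightarrow> bool" where
  "finite_simple_graph G \<longleftrightarrow>
     finite (verts G) \<and> (\<forall>e\<in>edges G. e \<subseteq> verts G \<and> card e = 2)"

definition adj :: "'a ugraph \<Rightarrow> 'a \<Rightarrow> 'a \<Rightarrow> bool" where
  "adj G u v \<longleftrightarrow> {u, v} \<in> edges G"

definition path_graph :: "nat \<Rightarrow> nat ugraph" where
  "path_graph k = \<lparr>verts = {..<k}, edges = {{i, Suc i} | i. Suc i < k}\<rparr>"

definition strong_product :: "'a ugraph \<Rightarrow> 'b ugraph \<Rightarrow> ('a \<times> 'b) ugraph" (infixl "\<boxtimes>" 70) where
  "G \<boxtimes> H =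
     \<lparr>verts = verts G \<times> verts H,
      edges = {{(v, u), (v', u')} | v u v' u'.
        v \<in> verts G \<and> v' \<in> verts G \<and> u \<in> verts H \<and> u' \<in> verts H \<and>
        (v = v' \<and> adj H u u' \<or> adj G v v' \<and> u = u' \<or> adj G v v' \<and> adj H u u')}\<rparr>"

definition dominating :: "'a ugraph \<Rightarrow> 'a set \<Rightarrow> bool" where
  "dominating G D \<longleftrightarrow> D \<subseteq> verts G \<and> (\<forall>v\<in>verts G. v \<in> D \<or> (\<exists>u\<in>D. adj G v u))"

definition domination_number :: "'a ugraph \<Rightarrow> nat" where
  "domination_number G = Inf {card D | D. dominating G D}"

definition delete_edges :: "'a ugraph \<Rightarrow> 'a set set \<Rightarrow> 'a ugraph" where
  "delete_edges G F = \<lparr>verts = verts G, edges = edges G - F\<rparr>"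

(* In a finite simple graph with an edge the set below is nonempty, so its infimum is a minimum.
   On nat the infimum of the empty set is 0, so a positive value also says that some deletion
   of edges increases the domination number. *)
definition bondage_number :: "'a ugraph \<Rightarrow> nat" where
  "bondage_number G =
     Inf {card F | F. F \<subseteq> edges G \<and> domination_number (delete_edges G F) > domination_number G}"

lemma finite_simple_path_graph: "finite_simple_graph (path_graph k)"
  unfolding finite_simple_graph_def path_graph_def by auto

lemma finite_simple_strong_product:
  assumes "finite_simple_graph G" and "finite_simple_graph H"
  shows "finite_simple_graph (G \<boxtimes> H)"
proof -
  have irr: "\<not> adj G v v" "\<not> adj H u u" for v u
    using assms unfolding finite_simple_graph_def adj_def by fastforce+
  show ?thesis
    using assms irr unfolding finite_simple_graph_def strong_product_def
    by (auto simp: card_insert_if)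
qed

lemma adj_path_graph: "adj (path_graph k) i j \<longleftrightarrow> i < k \<and> j < k \<and> (j = Suc i \<or> i = Suc j)"
  unfolding adj_def path_graph_def by (auto simp: doubleton_eq_iff)

lemma adj_commute: "adj G u v \<longleftrightarrow> adj G v u"
  unfolding adj_def by (simp add: insert_commute)

lemma adj_strong_product:
  "adj (G \<boxtimes> H) (v, u) (v', u') \<longleftrightarrow>
    v \<in> verts G \<and> v' \<in> verts G \<and> u \<in> verts H \<and> u' \<in> verts H \<and>
    (v = v' \<and> adj H u u' \<or> adj G v v' \<and> u = u' \<or> adj G v v' \<and> adj H u u')"
proof -
  have "adj (G \<boxtimes> H) (v, u) (v', u') \<longleftrightarrow> {(v, u), (v', u')} \<in> edges (G \<boxtimes> H)"
    by (simp add: adj_def)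
  then show ?thesis
    unfolding strong_product_def by (auto simp: doubleton_eq_iff adj_commute)
qed

lemma edges_strong_product_paths_nonempty:
  assumes "n \<ge> 2" and "m \<ge> 2"
  shows "edges (path_graph n \<boxtimes> path_graph m) \<noteq> {}"
proof -
  have "adj (path_graph n \<boxtimes> path_graph m) (0, 0) (0, 1)"
    using assms by (simp add: adj_strong_product adj_path_graph)
      (simp add: path_graph_def)
  then show ?thesis by (auto simp: adj_def)
qed

end

theory Submission
  imports Defs
begin

text \<open>
  The upper bound is an instance of a theorem of Hartnell and Rall: adjacent vertices \<open>u\<close>, \<open>v\<close> of a
  finite simple graph satisfy \<open>b(G) \<le> d(u) + |N(v) - N[u]|\<close>. Deleting all edges at \<open>u\<close>, together
  with the edges from \<open>v\<close> to vertices outside \<open>N[u]\<close>, isolates \<open>u\<close> and leaves \<open>v\<close> with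
  neighbours only among the former neighbours of \<open>u\<close>. A dominating set \<open>D\<close> of what remains must contain
  \<open>u\<close>, and must also contain a former neighbour of \<open>u\<close>, because something dominates \<open>v\<close>. Hence
  \<open>D - {u}\<close> still dominates the original graph, and the deletion has raised the domination number
  (\<open>domination_number_delete_separating_edges\<close>).

  In the strong product of two paths take \<open>u = (0, 0)\<close>, a corner with three neighbours, and
  \<open>v = (0, 1)\<close>, which has at most two neighbours outside \<open>N[u]\<close>, namely \<open>(0, 2)\<close> and \<open>(1, 2)\<close>.
  The same deletion witnesses that the domination number can be raised at all; since
  deleting nothing does not raise it, the bondage number is also at least 1.
\<close>

definition nbhd :: "'a ugraph \<Rightarrow> 'a \<Rightarrow> 'a set" where
  "nbhd G u = {w. adj G u w}"

text \<open>
  The edges from \<open>v\<close> to common neighbours of \<open>u\<close> and \<open>v\<close> are kept: a vertex that dominates \<open>v\<close>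
  through one of them also dominates \<open>u\<close> in the original graph. This saving makes the bound sharp
  enough for a corner of the grid.
\<close>

definition separating_edges :: "'a ugraph \<Rightarrow> 'a \<Rightarrow> 'a \<Rightarrow> 'a set set" where
  "separating_edges G u v =
     (\<lambda>w. {u, w}) ` nbhd G u \<union> (\<lambda>w. {v, w}) ` (nbhd G v - insert u (nbhd G u))"

lemma adj_delete_edges: "adj (delete_edges G F) x y \<longleftrightarrow> adj G x y \<and> {x, y} \<notin> F"
  by (auto simp: adj_def delete_edges_def)

lemma adj_imp_verts:
  assumes "finite_simple_graph G" "adj G u w"
  shows "u \<in> verts G" "w \<in> verts G"
  using assms unfolding finite_simple_graph_def adj_def by auto

lemma finite_nbhd:
  assumes "finite_simple_graph G"
  shows "finite (nbhd G u)"
proof -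
  have "nbhd G u \<subseteq> verts G"
    using adj_imp_verts(2)[OF assms] by (auto simp: nbhd_def)
  then show ?thesis
    using assms by (auto simp: finite_simple_graph_def intro: finite_subset)
qed

lemma domination_number_le:
  assumes "dominating G D"
  shows "domination_number G \<le> card D"
  unfolding domination_number_def using assms by (intro cInf_lower) auto

lemma minimum_dominating_set_exists:
  obtains D where "dominating G D" "card D = domination_number G"
proof -
  have "dominating G (verts G)"
    by (simp add: dominating_def)
  then have "{card D | D. dominating G D} \<noteq> {}"
    by blast
  from Inf_nat_def1[OF this] show thesis
    using that unfolding domination_number_def by force
qed

lemma separating_edges_subset: "separating_edges G u v \<subseteq> edges G"
  by (auto simp: separating_edges_def nbhd_def adj_def)

lemma card_separating_edges_le:
  assumes "finite_simple_graph G"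
  shows "card (separating_edges G u v) \<le> card (nbhd G u) + card (nbhd G v - insert u (nbhd G u))"
  unfolding separating_edges_def
  using finite_nbhd[OF assms]
  by (intro order_trans[OF card_Un_le] add_mono card_image_le) auto

text \<open>
  Two vertices of any dominating set of the remaining graph lie in the original closed neighbourhood
  of \<open>u\<close>: the isolated vertex \<open>u\<close> itself, and a vertex that dominates \<open>v\<close>. The first is redundant
  once the deleted edges are restored.
\<close>

lemma domination_number_delete_separating_edges:
  assumes G: "finite_simple_graph G" and uv: "adj G u v"
  shows "domination_number G < domination_number (delete_edges G (separating_edges G u v))"
proof -
  let ?H = "delete_edges G (separating_edges G u v)"
  obtain D where D: "dominating ?H D" and card_D: "card D = domination_number ?H"
    by (rule minimum_dominating_set_exists)
  have verts_H: "verts ?H = verts G"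
    by (simp add: delete_edges_def)
  have u: "u \<in> verts G" and v: "v \<in> verts G"
    using adj_imp_verts[OF G uv] .
  have D_sub: "D \<subseteq> verts G"
    using D by (simp add: dominating_def verts_H)
  have finite_D: "finite D"
    using D_sub G by (auto simp: finite_simple_graph_def intro: finite_subset)
  have "u \<noteq> v"
    using G uv unfolding finite_simple_graph_def adj_def by force
  have isolated_left: "\<not> adj ?H u w" for w
    by (auto simp: adj_delete_edges separating_edges_def nbhd_def)
  then have isolated: "\<not> adj ?H u w" "\<not> adj ?H w u" for w
    using adj_commute[of ?H w u] by blast+
  have adj_v: "adj G u w" if "adj ?H v w" for w
  proof -
    have "adj G v w" "{v, w} \<notin> separating_edges G u v" "w \<noteq> u"
      using that isolated by (auto simp: adj_delete_edges)
    then show ?thesis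
      by (auto simp: separating_edges_def nbhd_def)
  qed
  have "u \<in> D"
    using D u isolated by (auto simp: dominating_def verts_H)
  obtain w where w: "w \<in> D - {u}" "adj G u w"
    using D v uv adj_v isolated \<open>u \<noteq> v\<close> unfolding dominating_def verts_H by blast
  have "dominating G (D - {u})"
    unfolding dominating_def
  proof (intro conjI ballI)
    show "D - {u} \<subseteq> verts G"
      using D_sub by blast
    fix x
    assume x: "x \<in> verts G"
    show "x \<in> D - {u} \<or> (\<exists>y\<in>D - {u}. adj G x y)"
    proof (cases "x = u")
      case True
      then show ?thesis using w by blast
    next
      case False
      have "x \<in> D \<or> (\<exists>y\<in>D. adj ?H x y)"
        using D x by (simp add: dominating_def verts_H)
      then show ?thesis
        using False isolated(2) by (metis Diff_iff adj_delete_edges singletonD)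
    qed
  qed
  then have "domination_number G \<le> card (D - {u})"
    by (rule domination_number_le)
  also have "\<dots> < card D"
    using finite_D \<open>u \<in> D\<close> by (rule card_Diff1_less)
  finally show ?thesis
    by (simp add: card_D)
qed

lemma bondage_number_le:
  assumes "F \<subseteq> edges G" "domination_number G < domination_number (delete_edges G F)"
  shows "bondage_number G \<le> card F"
  unfolding bondage_number_def using assms by (intro cInf_lower) auto

text \<open>
  Hartnell and Rall state the bound as \<open>d(u) + d(v) - 1 - |N(u) \<inter> N(v)|\<close>. Since \<open>u\<close> is itself a
  neighbour of \<open>v\<close>, the two agree; counting \<open>N(v) - N[u]\<close> avoids truncated subtraction.
\<close>

theorem bondage_number_le_Hartnell_Rall:
  assumes "finite_simple_graph G" and "adj G u v"
  shows "bondage_number G \<le> card (nbhd G u) + card (nbhd G v - insert u (nbhd G u))"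
  using bondage_number_le[OF separating_edges_subset domination_number_delete_separating_edges[OF assms]]
    card_separating_edges_le[OF assms(1)] by (rule order_trans)

text \<open>
  The edge hypothesis matters: in an edgeless graph no deletion raises the domination number, and the
  infimum of the empty set of naturals is 0.
\<close>

lemma bondage_number_pos:
  assumes G: "finite_simple_graph G" and "adj G u v"
  shows "1 \<le> bondage_number G"
proof -
  let ?S = "{card F | F. F \<subseteq> edges G \<and> domination_number (delete_edges G F) > domination_number G}"
  have "card (separating_edges G u v) \<in> ?S"
    using separating_edges_subset[of G u v] domination_number_delete_separating_edges[OF assms]
    by simp (rule exI[of _ "separating_edges G u v"], simp)
  then have "?S \<noteq> {}"
    by (metis empty_iff)
  then have "bondage_number G \<in> ?S"
    unfolding bondage_number_def by (rule Inf_nat_def1)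
  then obtain F
    where F: "F \<subseteq> edges G" "domination_number G < domination_number (delete_edges G F)"
      and card_F: "card F = bondage_number G"
    by (elim CollectE exE conjE) simp
  have "finite (edges G)"
    using G unfolding finite_simple_graph_def by (auto intro: finite_subset[of _ "Pow (verts G)"])
  then have "finite F"
    using F(1) by (rule rev_finite_subset)
  moreover have "F \<noteq> {}"
    using F(2) by (cases G) (auto simp: delete_edges_def)
  ultimately show ?thesis
    by (simp add: card_F[symmetric] Suc_le_eq card_gt_0_iff)
qed

theorem theorem4:
  fixes n m :: nat
  assumes "n \<ge> 2" and "m \<ge> 2"
  shows "1 \<le> bondage_number (path_graph n \<boxtimes> path_graph m) \<and>
         bondage_number (path_graph n \<boxtimes> path_graph m) \<le> 5"
proof -
  let ?G = "path_graph n \<boxtimes> path_graph m"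
  let ?u = "(0, 0) :: nat \<times> nat" and ?v = "(0, 1) :: nat \<times> nat"
  have G: "finite_simple_graph ?G"
    by (intro finite_simple_strong_product finite_simple_path_graph)
  have verts_path: "verts (path_graph k) = {..<k}" for k
    by (simp add: path_graph_def)
  note adj_simps = adj_strong_product adj_path_graph verts_path
  have uv: "adj ?G ?u ?v"
    using assms by (simp add: adj_simps)
  have N_u: "nbhd ?G ?u = {(0, 1), (1, 0), (1, 1)}"
    using assms by (auto simp: nbhd_def adj_simps)
  have N_v: "nbhd ?G ?v - insert ?u (nbhd ?G ?u) \<subseteq> {(0, 2), (1, 2)}"
    unfolding N_u by (auto simp: nbhd_def adj_simps)
  have "card (nbhd ?G ?v - insert ?u (nbhd ?G ?u)) \<le> 2"
    using card_mono[OF _ N_v] by simp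
  moreover have "card (nbhd ?G ?u) = 3"
    by (simp add: N_u)
  ultimately have "bondage_number ?G \<le> 5"
    using bondage_number_le_Hartnell_Rall[OF G uv] by linarith
  with bondage_number_pos[OF G uv] show ?thesis
    by blast
qed

end
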